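(* Let $k\geq 1$ and $X=\{x_1,\dots,x_k\}$. Define $$V_k(x_1,\dots,x_k)=\sum_{n_1,\dots,n_k\geq 1}\frac{\prod_{j=1}^{k-1}\min(n_j,n_{j+1})}{n_1^{x_1}n_2^{x_2}\cdots n_k^{x_k}}.$$ Then $$V_k(x_1,\dots,x_k)=\sum_{S\in S(X)}\zeta_{l}(e_1,\dots,e_l),$$ where for each ordered partition $S=(S_1,\dots,S_l)$ of $X$ (with $l$ its number of blocks) and each $1\le i\le l$, $$e_i=\sum_{j:\,x_j\in S_i}\big(x_j-f_{i,j}^{+}-f_{i,j}^{-}\big),$$ with $f_{i,j}^{+}=1$ if $j+1\le k$ and $x_{j+1}\in S_t$ for some $1\le t\le i-1$, and $f_{i,j}^{+}=0$ otherwise; and $f_{i,j}^{-}=1$ if $j-1\ge 1$ and $x_{j-1}\in S_t$ for some $1\le t\le i$, and $f_{i,j}^{-}=0$ otherwise. The identity holds as an identity of formal multiple Dirichlet series (equivalently, for all complex $x_1,\dots,x_k$ for which the series defining $V_k$ converges absolutely).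
   Context: $V_k$ is the Dirichlet generating function of parallelogram polyominoes of width $k$, with $x_i$ marking the height of the $i$-th column. $S(X)$ denotes the set of all ordered set partitions of the finite set $X$, i.e. all sequences $(S_1,\dots,S_l)$ of nonempty pairwise disjoint subsets of $X$ whose union is $X$, with $l\geq 1$ arbitrary. For $l\ge1$, the multiple zeta function is $\zeta_l(e_1,\dots,e_l)=\sum_{n_1>n_2>\dots>n_l\geq 1}\frac{1}{n_1^{e_1}n_2^{e_2}\cdots n_l^{e_l}}$. *)

theory Defs
  imports "HOL-Analysis.Analysis" "HOL-Computational_Algebra.Polynomial"
begin

text \<open>The variables \<open>x\<^sub>1, \<dots>, x\<^sub>k\<close> are represented by their indices: a partition of
  \<open>X = {x\<^sub>1, \<dots>, x\<^sub>k}\<close> is a partition of \<open>{1..k}\<close>, so that the variables stay distinct even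
  when their values coincide. Tuples are 1-based.\<close>

definition pos_tuples :: "nat \<Rightarrow> (nat \<Rightarrow> nat) set" where
  "pos_tuples k = {1..k} \<rightarrow>\<^sub>E {1..}"

definition decr_tuples :: "nat \<Rightarrow> (nat \<Rightarrow> nat) set" where
  "decr_tuples l = {m \<in> pos_tuples l. strict_antimono_on {1..l} m}"

definition ordered_set_partitions :: "'a set \<Rightarrow> 'a set list set" where
  "ordered_set_partitions A =
     {S. length S \<ge> 1 \<and> (\<forall>i<length S. S ! i \<noteq> {}) \<and>
         (\<forall>i<length S. \<forall>j<length S. i \<noteq> j \<longrightarrow> S ! i \<inter> S ! j = {}) \<and>
         \<Union>(set S) = A}"

definition block :: "'a set list \<Rightarrow> nat \<Rightarrow> 'a set" where
  "block S i = S ! (i - 1)"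

definition f_plus :: "nat \<Rightarrow> nat set list \<Rightarrow> nat \<Rightarrow> nat \<Rightarrow> nat" where
  "f_plus k S i j = (if j + 1 \<le> k \<and> (\<exists>t. 1 \<le> t \<and> t \<le> i - 1 \<and> j + 1 \<in> block S t) then 1 else 0)"

definition f_minus :: "nat set list \<Rightarrow> nat \<Rightarrow> nat \<Rightarrow> nat" where
  "f_minus S i j = (if j - 1 \<ge> 1 \<and> (\<exists>t. 1 \<le> t \<and> t \<le> i \<and> j - 1 \<in> block S t) then 1 else 0)"

text \<open>The type of the values of the variables is left open, so that the same exponents serve for
  complex numbers and for formal variables.\<close>

definition expo :: "nat \<Rightarrow> (nat \<Rightarrow> 'a::ring_1) \<Rightarrow> nat set list \<Rightarrow> nat \<Rightarrow> 'a" where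
  "expo k x S i = (\<Sum>j\<in>block S i. x j - of_nat (f_plus k S i j) - of_nat (f_minus S i j))"

definition V_coeff :: "nat \<Rightarrow> (nat \<Rightarrow> nat) \<Rightarrow> nat" where
  "V_coeff k n = (\<Prod>j=1..k-1. min (n j) (n (j + 1)))"

definition V_term :: "nat \<Rightarrow> (nat \<Rightarrow> complex) \<Rightarrow> (nat \<Rightarrow> nat) \<Rightarrow> complex" where
  "V_term k x n = of_nat (V_coeff k n) / (\<Prod>j=1..k. of_nat (n j) powr x j)"

definition V :: "nat \<Rightarrow> (nat \<Rightarrow> complex) \<Rightarrow> complex" where
  "V k x = (\<Sum>\<^sub>\<infinity>n\<in>pos_tuples k. V_term k x n)"

definition mzeta_term :: "nat \<Rightarrow> (nat \<Rightarrow> complex) \<Rightarrow> (nat \<Rightarrow> nat) \<Rightarrow> complex" where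
  "mzeta_term l e m = 1 / (\<Prod>i=1..l. of_nat (m i) powr e i)"

definition mzeta :: "nat \<Rightarrow> (nat \<Rightarrow> complex) \<Rightarrow> complex" where
  "mzeta l e = (\<Sum>\<^sub>\<infinity>m\<in>decr_tuples l. mzeta_term l e m)"

text \<open>A formal multiple Dirichlet series in \<open>x\<^sub>1, \<dots>, x\<^sub>k\<close> is given by its coefficients at
  \<open>n\<^sub>1\<^bsup>-x\<^sub>1\<^esup> \<cdots> n\<^sub>k\<^bsup>-x\<^sub>k\<^esup>\<close>, for \<open>n \<in> pos_tuples k\<close>; those of \<open>V\<^sub>k\<close> are \<open>V_coeff k n\<close>.

  An integral affine form \<open>c + a\<^sub>1 x\<^sub>1 + \<dots> + a\<^sub>k x\<^sub>k\<close> is encoded as a polynomial with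
  constant coefficient \<open>c\<close> and \<open>j\<close>-th coefficient \<open>a\<^sub>j\<close>; the multiplication of polynomials
  plays no role. For affine forms \<open>e\<^sub>i = c\<^sub>i + \<Sum>\<^sub>j a\<^sub>i\<^sub>j x\<^sub>j\<close>, the term
  \<open>\<Prod>\<^sub>i m\<^sub>i\<^bsup>-e\<^sub>i\<^esup>\<close> of \<open>\<zeta>\<^sub>l(e\<^sub>1, \<dots>, e\<^sub>l)\<close> is \<open>\<Prod>\<^sub>i m\<^sub>i\<^bsup>-c\<^sub>i\<^esup>\<close> times
  \<open>\<Prod>\<^sub>j n\<^sub>j\<^bsup>-x\<^sub>j\<^esup>\<close>, where \<open>n\<^sub>j = \<Prod>\<^sub>i m\<^sub>i\<^bsup>a\<^sub>i\<^sub>j\<^esup>\<close>. The coefficient of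
  \<open>\<zeta>\<^sub>l(e\<^sub>1, \<dots>, e\<^sub>l)\<close> at \<open>n\<close> is meaningful if only finitely many terms contribute to it.\<close>

definition formal_var :: "nat \<Rightarrow> int poly" where
  "formal_var j = monom 1 j"

definition formal_mzeta_indices ::
    "nat \<Rightarrow> nat \<Rightarrow> (nat \<Rightarrow> int poly) \<Rightarrow> (nat \<Rightarrow> nat) \<Rightarrow> (nat \<Rightarrow> nat) set" where
  "formal_mzeta_indices k l e n =
     {m \<in> decr_tuples l. \<forall>j\<in>{1..k}. (of_nat (n j) :: rat) =
        (\<Prod>i=1..l. of_nat (m i) powi coeff (e i) j)}"

definition formal_mzeta_coeff ::
    "nat \<Rightarrow> nat \<Rightarrow> (nat \<Rightarrow> int poly) \<Rightarrow> (nat \<Rightarrow> nat) \<Rightarrow> rat" where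
  "formal_mzeta_coeff k l e n =
     (\<Sum>m\<in>formal_mzeta_indices k l e n. \<Prod>i=1..l. of_nat (m i) powi (- coeff (e i) 0))"

lemma finite_ordered_set_partitions:
  assumes "finite A"
  shows "finite (ordered_set_partitions A)"
proof (rule finite_subset)
  show "ordered_set_partitions A \<subseteq> {S. set S \<subseteq> Pow A \<and> distinct S}"
    unfolding ordered_set_partitions_def distinct_conv_nth by auto (metis inf.idem)
  show "finite {S. set S \<subseteq> Pow A \<and> distinct S}"
    using assms by (intro finite_subset_distinct) simp
qed

end

theory Submission
  imports Defs
begin

text \<open>Recording the distinct values \<open>m\<^sub>1 > \<dots> > m\<^sub>l\<close> of a tuple \<open>n\<close> together with the level
  sets \<open>S\<^sub>i = {j. n\<^sub>j = m\<^sub>i}\<close> is a bijection between positive \<open>k\<close>-tuples and pairs of an ordered set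
  partition of \<open>{1..k}\<close> and a decreasing tuple. Each factor \<open>min n\<^sub>j n\<^sub>j\<^sub>+\<^sub>1\<close> is charged to the index
  attaining it, ties going to \<open>j + 1\<close>; the numbers \<open>f\<^sup>+\<close> and \<open>f\<^sup>-\<close> count the factors charged
  to an index by its right and left neighbour. Hence the bijection matches the series term by term,
  formally as well as analytically.\<close>

section \<open>Ordered set partitions and the block of an index\<close>

definition block_index :: "'a set list \<Rightarrow> 'a \<Rightarrow> nat" where
  "block_index S j = (THE i. i \<in> {1..length S} \<and> j \<in> block S i)"

text \<open>The restricted lambda makes the result \<open>undefined\<close> outside
  \<open>A\<close>, as membership in the extensional function space \<open>pos_tuples k\<close>
  demands when \<open>A = {1..k}\<close>.\<close>

definition spread :: "'a set \<Rightarrow> 'a set list \<Rightarrow> (nat \<Rightarrow> nat) \<Rightarrow> 'a \<Rightarrow> nat" where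
  "spread A S m = (\<lambda>j\<in>A. m (block_index S j))"

lemma ordered_set_partitions_ex1_block:
  assumes "S \<in> ordered_set_partitions A" "j \<in> A"
  shows "\<exists>!i. i \<in> {1..length S} \<and> j \<in> block S i"
proof -
  from assms obtain i where i: "i < length S" "j \<in> S ! i"
    unfolding ordered_set_partitions_def by (auto simp: in_set_conv_nth)
  show ?thesis
  \<comment> \<open>\<open>block\<close> counts from 1, list positions from 0.\<close>
  proof (rule ex1I[of _ "Suc i"])
    show "Suc i \<in> {1..length S} \<and> j \<in> block S (Suc i)"
      using i by (auto simp: block_def)
    fix i' assume i': "i' \<in> {1..length S} \<and> j \<in> block S i'"
    then have "i' - 1 < length S" "j \<in> S ! (i' - 1)"
      by (auto simp: block_def)
    with i assms(1) have "i' - 1 = i"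
      unfolding ordered_set_partitions_def by blast
    with i' show "i' = Suc i" by auto
  qed
qed

lemma block_index:
  assumes "S \<in> ordered_set_partitions A" "j \<in> A"
  shows "block_index S j \<in> {1..length S}" "j \<in> block S (block_index S j)"
  using theI'[OF ordered_set_partitions_ex1_block[OF assms]] by (auto simp: block_index_def)

lemma block_subset:
  assumes "S \<in> ordered_set_partitions A" "i \<in> {1..length S}"
  shows "block S i \<subseteq> A"
proof -
  from assms(2) have "block S i \<in> set S" by (auto simp: block_def)
  with assms(1) show ?thesis unfolding ordered_set_partitions_def by auto
qed

lemma block_index_eq_iff:
  assumes "S \<in> ordered_set_partitions A" "j \<in> A" "i \<in> {1..length S}"
  shows "block_index S j = i \<longleftrightarrow> j \<in> block S i"
  using ordered_set_partitions_ex1_block[OF assms(1,2)] block_index[OF assms(1,2)] assms(3) by blast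

lemma block_eq_Collect:
  assumes "S \<in> ordered_set_partitions A" "i \<in> {1..length S}"
  shows "block S i = {j \<in> A. block_index S j = i}"
  using block_subset[OF assms] block_index_eq_iff[OF assms(1) _ assms(2)] by blast

lemma block_nonempty:
  assumes "S \<in> ordered_set_partitions A" "i \<in> {1..length S}"
  shows "block S i \<noteq> {}"
proof -
  from assms(2) have "i - 1 < length S" by auto
  with assms(1) show ?thesis unfolding ordered_set_partitions_def block_def by blast
qed

text \<open>Surjectivity comes from the blocks being nonempty. It ensures that
  \<open>spread A S m\<close> takes every value \<open>m i\<close>, so that \<open>m\<close> can be
  recovered from it.\<close>

lemma block_index_image:
  assumes "S \<in> ordered_set_partitions A"
  shows "block_index S ` A = {1..length S}"
proof
  show "block_index S ` A \<subseteq> {1..length S}"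
    using block_index(1)[OF assms] by (rule image_subsetI)
  show "{1..length S} \<subseteq> block_index S ` A"
  proof
    fix i assume i: "i \<in> {1..length S}"
    then obtain j where "j \<in> block S i" using block_nonempty[OF assms] by blast
    then show "i \<in> block_index S ` A" unfolding block_eq_Collect[OF assms i] by blast
  qed
qed

section \<open>Strictly decreasing tuples\<close>

lemma decr_tuples_less_iff:
  assumes "m \<in> decr_tuples l" "i \<in> {1..l}" "i' \<in> {1..l}"
  shows "m i < m i' \<longleftrightarrow> i' < i"
proof -
  have "m b < m a" if "a < b" "a \<in> {1..l}" "b \<in> {1..l}" for a b
    using assms(1) that unfolding decr_tuples_def monotone_on_def by blast
  from this[of i i'] this[of i' i] assms(2,3) show ?thesis
    by (cases i i' rule: linorder_cases) auto
qed

lemma decr_tuples_inj_on: "m \<in> decr_tuples l \<Longrightarrow> inj_on m {1..l}"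
  by (rule inj_onI) (metis decr_tuples_less_iff linorder_neqE_nat less_irrefl)

lemma decr_tuples_pos: "m \<in> decr_tuples l \<Longrightarrow> i \<in> {1..l} \<Longrightarrow> m i > 0"
  unfolding decr_tuples_def pos_tuples_def by (force simp: PiE_iff)

text \<open>A finite set of naturals has only one decreasing enumeration, and outside
  \<open>{1..l}\<close> both tuples are \<open>undefined\<close>.\<close>

lemma decr_tuples_eqI:
  assumes "m \<in> decr_tuples l" "m' \<in> decr_tuples l" "m ` {1..l} = m' ` {1..l}"
  shows "m = m'"
proof -
  \<comment> \<open>Uniqueness of sorted lists is about increasing ones, hence the reversed index
    list.\<close>
  have sorted: "sorted_wrt (<) (map m'' (rev [1..<Suc l]))" if "m'' \<in> decr_tuples l" for m''
    using that unfolding sorted_wrt_map sorted_wrt_rev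
    by (auto simp: sorted_wrt_iff_nth_less decr_tuples_less_iff simp del: upt_Suc)
  have "map m (rev [1..<Suc l]) = map m' (rev [1..<Suc l])"
    by (rule strict_sorted_equal[OF sorted sorted])
       (use assms in \<open>simp_all add: atLeastLessThanSuc_atLeastAtMost del: upt_Suc\<close>)
  then have "m i = m' i" if "i \<in> {1..l}" for i
    using that by (simp add: rev_map[symmetric] map_eq_conv del: upt_Suc)
  moreover have "m \<in> {1..l} \<rightarrow>\<^sub>E {1..}" "m' \<in> {1..l} \<rightarrow>\<^sub>E {1..}"
    using assms(1,2) by (simp_all add: decr_tuples_def pos_tuples_def)
  ultimately show ?thesis by (rule PiE_ext[rotated 2])
qed

section \<open>The bijection with positive tuples\<close>

lemma spread_image:
  assumes "S \<in> ordered_set_partitions A"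
  shows "spread A S m ` A = m ` {1..length S}"
  unfolding block_index_image[OF assms, symmetric] image_image by (simp add: spread_def)

lemma spread_in_pos_tuples:
  assumes "S \<in> ordered_set_partitions {1..k}" "m \<in> decr_tuples (length S)"
  shows "spread {1..k} S m \<in> pos_tuples k"
  using decr_tuples_pos[OF assms(2) block_index(1)[OF assms(1)]]
  by (force simp: pos_tuples_def spread_def)

text \<open>A decreasing tuple is injective, so different blocks receive different values and the
  blocks are recovered as level sets.\<close>

lemma block_spread:
  assumes "S \<in> ordered_set_partitions A" "m \<in> decr_tuples (length S)" "i \<in> {1..length S}"
  shows "block S i = {j \<in> A. spread A S m j = m i}"
  using inj_onD[OF decr_tuples_inj_on[OF assms(2)] _ _ assms(3)] block_index(1)[OF assms(1)]
  unfolding block_eq_Collect[OF assms(1,3)] spread_def by auto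

text \<open>The image of the spread tuple is the value set of \<open>m\<close>, and its cardinality
  is the number of blocks. This fixes \<open>m\<close>, after which the blocks are level sets of the
  same function.\<close>

lemma spread_eqD:
  assumes S: "S \<in> ordered_set_partitions A" "m \<in> decr_tuples (length S)"
    and S': "S' \<in> ordered_set_partitions A" "m' \<in> decr_tuples (length S')"
    and eq: "spread A S m = spread A S' m'"
  shows "S = S' \<and> m = m'"
proof -
  have im: "m ` {1..length S} = m' ` {1..length S'}"
    using spread_image[OF S(1)] spread_image[OF S'(1)] eq by metis
  have len: "length S = length S'"
    using arg_cong[OF im, of card] decr_tuples_inj_on[OF S(2)] decr_tuples_inj_on[OF S'(2)]
    by (simp add: card_image)
  have m: "m = m'"
    using decr_tuples_eqI S(2) S'(2) im unfolding len by blast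
  have "S ! i = S' ! i" if "i < length S" for i
  proof -
    have "block S (Suc i) = block S' (Suc i)"
      using block_spread[OF S, of "Suc i"] block_spread[OF S', of "Suc i"] that len m eq by simp
    then show ?thesis by (simp add: block_def)
  qed
  with len m show ?thesis by (simp add: nth_equalityI)
qed

lemma spread_surj:
  assumes "k \<ge> 1" "n \<in> pos_tuples k"
  shows "\<exists>S\<in>ordered_set_partitions {1..k}. \<exists>m\<in>decr_tuples (length S). spread {1..k} S m = n"
proof -
  \<comment> \<open>The distinct values of \<open>n\<close> in decreasing order; \<open>S\<close>
    lists their level sets, and \<open>m\<close> is the same list as a 1-based tuple.\<close>
  define vs where "vs = rev (sorted_list_of_set (n ` {1..k}))"
  define S where "S = map (\<lambda>v. {j \<in> {1..k}. n j = v}) vs"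
  define m where "m = (\<lambda>i\<in>{1..length vs}. vs ! (i - 1))"
  have set_vs: "set vs = n ` {1..k}" by (simp add: vs_def)
  have sorted_vs: "sorted_wrt (>) vs"
    unfolding vs_def sorted_wrt_rev by simp
  have dist_vs: "distinct vs" by (simp add: vs_def)
  have len: "length S = length vs" by (simp add: S_def)
  have S: "S \<in> ordered_set_partitions {1..k}"
  proof -
    \<comment> \<open>Here \<open>k \<ge> 1\<close> enters: a partition must have at least one
      block.\<close>
    have "vs \<noteq> []" using set_vs assms(1) by force
    moreover have "S ! i \<noteq> {}" if "i < length S" for i
      using that set_vs nth_mem[of i vs] by (auto simp: S_def)
    moreover have "S ! i \<inter> S ! j = {}" if "i < length S" "j < length S" "i \<noteq> j" for i j
      using that nth_eq_iff_index_eq[OF dist_vs] by (auto simp: S_def)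
    moreover have "\<Union>(set S) = {1..k}"
      using set_vs by (auto simp: S_def)
    ultimately show ?thesis
      unfolding ordered_set_partitions_def by (simp add: len Suc_le_eq flip: length_greater_0_conv)
  qed
  have pos: "v \<ge> 1" if "v \<in> set vs" for v
    using that set_vs assms(2) by (auto simp: pos_tuples_def PiE_iff)
  have m: "m \<in> decr_tuples (length S)"
    using sorted_vs
    by (auto simp: decr_tuples_def pos_tuples_def m_def len monotone_on_def
        sorted_wrt_iff_nth_less intro!: pos[simplified])
  have "spread {1..k} S m j = n j" for j
  proof (cases "j \<in> {1..k}")
    case True
    define i where "i = block_index S j"
    have i: "i \<in> {1..length vs}" "j \<in> block S i"
      using block_index[OF S True] len by (simp_all add: i_def)
    then have "n j = vs ! (i - 1)"
      by (auto simp: block_def S_def)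
    with i True show ?thesis by (simp add: spread_def m_def i_def)
  next
    case False
    then show ?thesis
      using assms(2) by (auto simp: spread_def pos_tuples_def PiE_iff extensional_def)
  qed
  then have "spread {1..k} S m = n" by blast
  with S m show ?thesis by blast
qed

lemma bij_betw_spread:
  assumes "k \<ge> 1"
  shows "bij_betw (\<lambda>(S, m). spread {1..k} S m)
           (SIGMA S:ordered_set_partitions {1..k}. decr_tuples (length S)) (pos_tuples k)"
  unfolding bij_betw_def
proof
  show "inj_on (\<lambda>(S, m). spread {1..k} S m)
          (SIGMA S:ordered_set_partitions {1..k}. decr_tuples (length S))"
    by (rule inj_onI) (auto dest: spread_eqD)
  show "(\<lambda>(S, m). spread {1..k} S m) `
          (SIGMA S:ordered_set_partitions {1..k}. decr_tuples (length S)) = pos_tuples k"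
    using spread_in_pos_tuples spread_surj[OF assms] by (force simp: image_iff)
qed

section \<open>The product of minima, block by block\<close>

lemma prod_over_blocks:
  fixes g :: "nat \<Rightarrow> 'a \<Rightarrow> 'b::comm_monoid_mult"
  assumes "S \<in> ordered_set_partitions A" "finite A"
  shows "(\<Prod>i=1..length S. \<Prod>j\<in>block S i. g i j) = (\<Prod>j\<in>A. g (block_index S j) j)"
proof -
  \<comment> \<open>The blocks are the fibres of \<open>block_index\<close>, so the product is
    regrouped by fibres.\<close>
  have "(\<Prod>j\<in>A. g (block_index S j) j) =
          (\<Prod>i=1..length S. \<Prod>j\<in>{j \<in> A. block_index S j = i}. g (block_index S j) j)"
    using block_index(1)[OF assms(1)] assms(2) by (intro prod.group[symmetric]) auto
  also have "\<dots> = (\<Prod>i=1..length S. \<Prod>j\<in>block S i. g i j)"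
    by (intro prod.cong) (auto simp: block_eq_Collect[OF assms(1)])
  finally show ?thesis ..
qed

text \<open>As \<open>m\<close> decreases, an earlier block means a larger value. So
  \<open>j + 1\<close> lies in an earlier block exactly when the minimum over \<open>j\<close> and
  \<open>j + 1\<close> is attained at \<open>j\<close> alone.\<close>

lemma f_plus_spread:
  assumes S: "S \<in> ordered_set_partitions {1..k}" and m: "m \<in> decr_tuples (length S)"
    and j: "j \<in> {1..k}"
  shows "f_plus k S (block_index S j) j =
           (if j + 1 \<le> k \<and> spread {1..k} S m j < spread {1..k} S m (j + 1) then 1 else 0)"
proof (cases "j + 1 \<le> k")
  case True
  then have j': "j + 1 \<in> {1..k}" by simp
  note b = block_index(1)[OF S j] block_index(1)[OF S j']
  \<comment> \<open>Together with \<open>1 \<le> t\<close>, the truncated bound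
    \<open>t \<le> i - 1\<close> means \<open>t < i\<close>.\<close>
  have "(\<exists>t. 1 \<le> t \<and> t \<le> block_index S j - 1 \<and> j + 1 \<in> block S t) \<longleftrightarrow>
          block_index S (j + 1) < block_index S j"
  proof
    assume "\<exists>t. 1 \<le> t \<and> t \<le> block_index S j - 1 \<and> j + 1 \<in> block S t"
    then obtain t where t: "1 \<le> t" "t \<le> block_index S j - 1" "j + 1 \<in> block S t" by blast
    then show "block_index S (j + 1) < block_index S j"
      using b block_index_eq_iff[OF S j', of t] by auto
  next
    assume "block_index S (j + 1) < block_index S j"
    then show "\<exists>t. 1 \<le> t \<and> t \<le> block_index S j - 1 \<and> j + 1 \<in> block S t"
      using b block_index(2)[OF S j'] by (intro exI[of _ "block_index S (j + 1)"]) auto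
  qed
  also have "\<dots> \<longleftrightarrow> spread {1..k} S m j < spread {1..k} S m (j + 1)"
    using decr_tuples_less_iff[OF m b] j j' by (simp add: spread_def)
  finally show ?thesis by (simp add: f_plus_def)
qed (simp add: f_plus_def)

text \<open>The bound \<open>t \<le> i\<close> admits the block of \<open>j\<close> itself, hence
  the non-strict comparison: a tie between \<open>j - 1\<close> and \<open>j\<close> is charged to
  \<open>j\<close>, and no factor is counted twice.\<close>

lemma f_minus_spread:
  assumes S: "S \<in> ordered_set_partitions {1..k}" and m: "m \<in> decr_tuples (length S)"
    and j: "j \<in> {1..k}"
  shows "f_minus S (block_index S j) j =
           (if j - 1 \<ge> 1 \<and> spread {1..k} S m j \<le> spread {1..k} S m (j - 1) then 1 else 0)"
proof (cases "j - 1 \<ge> 1")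
  case True
  then have j': "j - 1 \<in> {1..k}" using j by auto
  note b = block_index(1)[OF S j] block_index(1)[OF S j']
  have "(\<exists>t. 1 \<le> t \<and> t \<le> block_index S j \<and> j - 1 \<in> block S t) \<longleftrightarrow>
          block_index S (j - 1) \<le> block_index S j"
  proof
    assume "\<exists>t. 1 \<le> t \<and> t \<le> block_index S j \<and> j - 1 \<in> block S t"
    then obtain t where t: "1 \<le> t" "t \<le> block_index S j" "j - 1 \<in> block S t" by blast
    then show "block_index S (j - 1) \<le> block_index S j"
      using b block_index_eq_iff[OF S j', of t] by auto
  next
    assume "block_index S (j - 1) \<le> block_index S j"
    then show "\<exists>t. 1 \<le> t \<and> t \<le> block_index S j \<and> j - 1 \<in> block S t"
      using b block_index(2)[OF S j'] by (intro exI[of _ "block_index S (j - 1)"]) auto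
  qed
  also have "\<dots> \<longleftrightarrow> spread {1..k} S m j \<le> spread {1..k} S m (j - 1)"
    using decr_tuples_less_iff[OF m b(2,1)] j j' by (simp add: spread_def not_less[symmetric])
  finally show ?thesis by (simp add: f_minus_def)
qed (simp add: f_minus_def)

text \<open>The minimum over \<open>j\<close> and \<open>j + 1\<close> is \<open>n j\<close> if
  \<open>n j < n (j + 1)\<close> and \<open>n (j + 1)\<close> otherwise; the exponents arise from
  collecting these factors by the index charged.\<close>

lemma V_coeff_eq_prod:
  assumes "k \<ge> 1"
  shows "V_coeff k n = (\<Prod>j=1..k. n j ^ ((if j + 1 \<le> k \<and> n j < n (j + 1) then 1 else 0) +
                                      (if j - 1 \<ge> 1 \<and> n j \<le> n (j - 1) then 1 else 0)))"
proof -
  obtain k' where k: "k = Suc k'" using assms by (cases k) auto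
  \<comment> \<open>At \<open>j = k\<close> the exponent is 0, so only the indices with a right
    neighbour remain.\<close>
  have plus: "(\<Prod>j=1..k. n j ^ (if j + 1 \<le> k \<and> n j < n (j + 1) then 1 else 0)) =
          (\<Prod>j=1..k'. if n j < n (j + 1) then n j else 1)"
    unfolding k by (simp add: prod.nat_ivl_Suc', intro prod.cong) auto
  \<comment> \<open>At \<open>j = 1\<close> the exponent is 0; shifting the index by one then names
    each pair by its left member, as in \<open>plus\<close>.\<close>
  have "(\<Prod>j=1..k. n j ^ (if j - 1 \<ge> 1 \<and> n j \<le> n (j - 1) then 1 else 0)) =
          (\<Prod>j=2..k. n j ^ (if n j \<le> n (j - 1) then 1 else 0))"
    unfolding k by (rule prod.mono_neutral_cong_right) auto
  also have "\<dots> = (\<Prod>j=1..k'. if n j < n (j + 1) then 1 else n (j + 1))"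
    unfolding k numeral_2_eq_2 prod.shift_bounds_cl_Suc_ivl by (intro prod.cong) auto
  finally have minus: "(\<Prod>j=1..k. n j ^ (if j - 1 \<ge> 1 \<and> n j \<le> n (j - 1) then 1 else 0)) =
          (\<Prod>j=1..k'. if n j < n (j + 1) then 1 else n (j + 1))" .
  have "V_coeff k n = (\<Prod>j=1..k'. (if n j < n (j + 1) then n j else 1) *
                                  (if n j < n (j + 1) then 1 else n (j + 1)))"
    unfolding V_coeff_def k by (intro prod.cong) auto
  then show ?thesis
    unfolding power_add prod.distrib plus minus .
qed

text \<open>The exponents are the numbers that \<open>expo\<close> subtracts; both the analytic and
  the formal comparison of terms rest on this.\<close>

lemma V_coeff_spread:
  assumes k: "k \<ge> 1" and S: "S \<in> ordered_set_partitions {1..k}"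
    and m: "m \<in> decr_tuples (length S)"
  shows "V_coeff k (spread {1..k} S m) =
           (\<Prod>i=1..length S. \<Prod>j\<in>block S i. m i ^ (f_plus k S i j + f_minus S i j))"
proof -
  have "V_coeff k (spread {1..k} S m) =
          (\<Prod>j=1..k. spread {1..k} S m j ^
             (f_plus k S (block_index S j) j + f_minus S (block_index S j) j))"
    unfolding V_coeff_eq_prod[OF k]
    by (intro prod.cong) (simp_all only: f_plus_spread[OF S m] f_minus_spread[OF S m])
  also have "\<dots> = (\<Prod>j=1..k. m (block_index S j) ^
             (f_plus k S (block_index S j) j + f_minus S (block_index S j) j))"
    by (intro prod.cong) (simp_all add: spread_def)
  also have "\<dots> = (\<Prod>i=1..length S. \<Prod>j\<in>block S i. m i ^ (f_plus k S i j + f_minus S i j))"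
    using prod_over_blocks[OF S, of "\<lambda>i j. m i ^ (f_plus k S i j + f_minus S i j)"] by simp
  finally show ?thesis .
qed

section \<open>Matching the analytic terms\<close>

lemma V_term_spread:
  assumes k: "k \<ge> 1" and S: "S \<in> ordered_set_partitions {1..k}"
    and m: "m \<in> decr_tuples (length S)"
  shows "V_term k x (spread {1..k} S m) = mzeta_term (length S) (expo k x S) m"
proof -
  \<comment> \<open>Within a block, the \<open>x j\<close> yield the denominator of
    \<open>V_term\<close>, and the subtracted numbers yield its numerator by
    \<open>V_coeff_spread\<close>.\<close>
  have "of_nat (m i) powr expo k x S i =
      (\<Prod>j\<in>block S i. of_nat (m i) powr x j) /
      of_nat (\<Prod>j\<in>block S i. m i ^ (f_plus k S i j + f_minus S i j))"
    if i: "i \<in> {1..length S}" for i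
  proof -
    \<comment> \<open>As \<open>0 powr 0\<close> is 0, splitting a sum in the exponent and reading
      natural exponents as powers rely on a nonzero base.\<close>
    have mi: "of_nat (m i) \<noteq> (0::complex)" using decr_tuples_pos[OF m i] by simp
    have "of_nat (m i) powr expo k x S i = (\<Prod>j\<in>block S i.
        of_nat (m i) powr (x j - of_nat (f_plus k S i j) - of_nat (f_minus S i j)))"
      using finite_subset[OF block_subset[OF S i]] mi by (simp add: expo_def powr_sum)
    also have "\<dots> = (\<Prod>j\<in>block S i. of_nat (m i) powr x j /
        of_nat (m i ^ (f_plus k S i j + f_minus S i j)))"
      using mi by (intro prod.cong) (simp_all add: powr_diff powr_nat' power_add)
    finally show ?thesis by (simp add: prod_dividef)
  qed
  then have "(\<Prod>i=1..length S. of_nat (m i) powr expo k x S i) =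
      (\<Prod>i=1..length S. \<Prod>j\<in>block S i. of_nat (m i) powr x j) /
      of_nat (V_coeff k (spread {1..k} S m))"
    unfolding V_coeff_spread[OF assms] by (simp add: prod_dividef)
  also have "(\<Prod>i=1..length S. \<Prod>j\<in>block S i. of_nat (m i) powr x j) =
      (\<Prod>j=1..k. of_nat (spread {1..k} S m j) powr x j)"
    using prod_over_blocks[OF S, of "\<lambda>i j. of_nat (m i) powr x j"] by (simp add: spread_def)
  finally show ?thesis
    by (simp add: V_term_def mzeta_term_def)
qed

section \<open>Matching the formal coefficients\<close>

lemma coeff_expo_formal_var:
  assumes "S \<in> ordered_set_partitions {1..k}" "i \<in> {1..length S}" "j \<in> {1..k}"
  shows "coeff (expo k formal_var S i) j = (if j \<in> block S i then 1 else 0)"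
  \<comment> \<open>As \<open>j \<ge> 1\<close>, coefficient \<open>j\<close> sees only the
    variables; the subtracted constants sit at coefficient 0.\<close>
  using assms(3) finite_subset[OF block_subset[OF assms(1,2)]]
  by (cases j) (auto simp: expo_def coeff_sum formal_var_def of_nat_poly)

lemma coeff_0_expo_formal_var:
  assumes "S \<in> ordered_set_partitions {1..k}" "i \<in> {1..length S}"
  shows "- coeff (expo k formal_var S i) 0 = (\<Sum>j\<in>block S i. int (f_plus k S i j + f_minus S i j))"
proof -
  \<comment> \<open>Indices in a block are at least 1, so no variable contributes a
    constant.\<close>
  have "coeff (formal_var j) 0 = 0" if "j \<in> block S i" for j
    using block_subset[OF assms] that by (auto simp: formal_var_def)
  then show ?thesis
    by (simp add: expo_def coeff_sum of_nat_poly sum_negf[symmetric] add.commute)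
qed

text \<open>The variable coefficients form the 0/1 incidence matrix of blocks and indices, so each
  product over \<open>i\<close> collapses to \<open>m (block_index S j)\<close>.\<close>

lemma formal_mzeta_indices_eq:
  assumes S: "S \<in> ordered_set_partitions {1..k}" and n: "n \<in> pos_tuples k"
  shows "formal_mzeta_indices k (length S) (expo k formal_var S) n =
           {m \<in> decr_tuples (length S). spread {1..k} S m = n}"
proof -
  have "(\<Prod>i=1..length S. of_nat (m i) powi coeff (expo k formal_var S i) j) =
          (of_nat (spread {1..k} S m j) :: rat)" if j: "j \<in> {1..k}" for m j
  proof -
    have "(\<Prod>i=1..length S. of_nat (m i) powi coeff (expo k formal_var S i) j) =
            (\<Prod>i=1..length S. if i = block_index S j then of_nat (m i) else (1 :: rat))"
      using block_index_eq_iff[OF S j] j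
      by (intro prod.cong) (auto simp: coeff_expo_formal_var[OF S])
    then show ?thesis
      using block_index(1)[OF S j] j by (simp add: spread_def)
  qed
  \<comment> \<open>Both functions are \<open>undefined\<close> outside \<open>{1..k}\<close>, so
    agreement inside suffices.\<close>
  moreover have "spread {1..k} S m = n \<longleftrightarrow> (\<forall>j\<in>{1..k}. n j = spread {1..k} S m j)" for m
    using n by (auto simp: fun_eq_iff spread_def pos_tuples_def PiE_iff extensional_def)
  ultimately show ?thesis
    unfolding formal_mzeta_indices_def by simp
qed

text \<open>All contributing \<open>m\<close> have the same weight, since the constant parts
  multiply to the product of minima at \<open>spread {1..k} S m = n\<close>.\<close>

lemma formal_mzeta_coeff_eq:
  assumes k: "k \<ge> 1" and S: "S \<in> ordered_set_partitions {1..k}" and n: "n \<in> pos_tuples k"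
  shows "formal_mzeta_coeff k (length S) (expo k formal_var S) n =
           (\<Sum>m | m \<in> decr_tuples (length S) \<and> spread {1..k} S m = n. of_nat (V_coeff k n))"
  unfolding formal_mzeta_coeff_def formal_mzeta_indices_eq[OF S n]
proof (intro sum.cong refl)
  fix m assume "m \<in> {m \<in> decr_tuples (length S). spread {1..k} S m = n}"
  then have m: "m \<in> decr_tuples (length S)" and eq: "spread {1..k} S m = n" by auto
  show "(\<Prod>i=1..length S. of_nat (m i) powi (- coeff (expo k formal_var S i) 0)) =
          (of_nat (V_coeff k n) :: rat)"
    unfolding eq[symmetric] V_coeff_spread[OF k S m] of_nat_prod
  proof (intro prod.cong refl)
    fix i assume i: "i \<in> {1..length S}"
    show "of_nat (m i) powi (- coeff (expo k formal_var S i) 0) =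
        (\<Prod>j\<in>block S i. of_nat (m i ^ (f_plus k S i j + f_minus S i j)) :: rat)"
      unfolding coeff_0_expo_formal_var[OF S i]
      by (simp only: of_nat_sum[symmetric] power_int_of_nat power_sum of_nat_power)
  qed
qed

section \<open>Summation over the bijection, formally and analytically\<close>

theorem theorem1:
  fixes k :: nat
  assumes "k \<ge> 1"
  shows
    "(\<forall>n\<in>pos_tuples k.
        (\<forall>S\<in>ordered_set_partitions {1..k}.
           finite (formal_mzeta_indices k (length S) (expo k formal_var S) n)) \<and>
        of_nat (V_coeff k n) =
          (\<Sum>S\<in>ordered_set_partitions {1..k}.
             formal_mzeta_coeff k (length S) (expo k formal_var S) n))
     \<and>
     (\<forall>x :: nat \<Rightarrow> complex.
        (\<lambda>n. norm (V_term k x n)) summable_on pos_tuples k \<longrightarrow>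
        (\<forall>S\<in>ordered_set_partitions {1..k}.
           (\<lambda>m. norm (mzeta_term (length S) (expo k x S) m)) summable_on decr_tuples (length S)) \<and>
        V k x = (\<Sum>S\<in>ordered_set_partitions {1..k}. mzeta (length S) (expo k x S)))"
proof (intro conjI ballI allI impI)
  fix n S
  assume n: "n \<in> pos_tuples k" and S: "S \<in> ordered_set_partitions {1..k}"
  \<comment> \<open>For a fixed partition, at most one decreasing tuple yields
    \<open>n\<close>.\<close>
  have "inj_on (spread {1..k} S) (decr_tuples (length S))"
    using spread_eqD[OF S _ S] by (auto intro: inj_onI)
  then have "finite (spread {1..k} S -` {n} \<inter> decr_tuples (length S))"
    by (rule finite_vimage_IntI[rotated]) simp
  then show "finite (formal_mzeta_indices k (length S) (expo k formal_var S) n)"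
    unfolding formal_mzeta_indices_eq[OF S n] by (rule rev_finite_subset) auto
next
  fix n assume n: "n \<in> pos_tuples k"
  obtain S m where S: "S \<in> ordered_set_partitions {1..k}" and m: "m \<in> decr_tuples (length S)"
    and eq: "spread {1..k} S m = n"
    using spread_surj[OF assms n] by blast
  \<comment> \<open>By injectivity \<open>n\<close> comes from the pair of \<open>S\<close> and
    \<open>m\<close> only, so a single summand survives in the sum over partitions.\<close>
  have "S' = S \<and> {m' \<in> decr_tuples (length S'). spread {1..k} S' m' = n} = {m} \<or>
        S' \<noteq> S \<and> {m' \<in> decr_tuples (length S'). spread {1..k} S' m' = n} = {}"
    if "S' \<in> ordered_set_partitions {1..k}" for S'
    using spread_eqD[OF that _ S m, unfolded eq] m eq by blast
  then have "formal_mzeta_coeff k (length S') (expo k formal_var S') n =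
      (if S' = S then of_nat (V_coeff k n) else 0)"
    if "S' \<in> ordered_set_partitions {1..k}" for S'
    using that unfolding formal_mzeta_coeff_eq[OF assms that n]
    by (metis (lifting) sum.empty sum.insert finite.emptyI empty_iff add_0_right)
  then show "of_nat (V_coeff k n) =
      (\<Sum>S\<in>ordered_set_partitions {1..k}. formal_mzeta_coeff k (length S) (expo k formal_var S) n)"
    using S by (simp add: finite_ordered_set_partitions)
next
  fix x :: "nat \<Rightarrow> complex" and S
  assume sum: "(\<lambda>n. norm (V_term k x n)) summable_on pos_tuples k"
    and S: "S \<in> ordered_set_partitions {1..k}"
  \<comment> \<open>The zeta series of \<open>S\<close> is, term by term, the subseries of
    \<open>V\<close> over the image of \<open>spread {1..k} S\<close>, so it inherits absolute
    convergence.\<close>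
  have "inj_on (spread {1..k} S) (decr_tuples (length S))"
    using spread_eqD[OF S _ S] by (auto intro: inj_onI)
  moreover have "(\<lambda>n. norm (V_term k x n)) summable_on spread {1..k} S ` decr_tuples (length S)"
    using spread_in_pos_tuples[OF S] by (intro summable_on_subset_banach[OF sum]) auto
  ultimately have "(\<lambda>m. norm (V_term k x (spread {1..k} S m))) summable_on decr_tuples (length S)"
    by (simp add: summable_on_reindex o_def)
  then show "(\<lambda>m. norm (mzeta_term (length S) (expo k x S) m)) summable_on decr_tuples (length S)"
    by (simp add: V_term_spread[OF assms S] del: One_nat_def cong: summable_on_cong)
next
  fix x :: "nat \<Rightarrow> complex"
  assume "(\<lambda>n. norm (V_term k x n)) summable_on pos_tuples k"
  then have sum: "V_term k x summable_on pos_tuples k"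
    by (rule abs_summable_summable)
  let ?D = "SIGMA S:ordered_set_partitions {1..k}. decr_tuples (length S)"
  \<comment> \<open>Summability over the pairs is what permits writing the reindexed sum as an
    iterated one.\<close>
  have "(\<lambda>(S, m). V_term k x (spread {1..k} S m)) summable_on ?D"
    using summable_on_reindex_bij_betw[OF bij_betw_spread[OF assms], of "V_term k x"] sum
    by (simp add: case_prod_unfold)
  moreover have "V k x = infsum (\<lambda>(S, m). V_term k x (spread {1..k} S m)) ?D"
    using infsum_reindex_bij_betw[OF bij_betw_spread[OF assms], of "V_term k x"]
    by (simp add: V_def case_prod_unfold)
  ultimately have "V k x = (\<Sum>\<^sub>\<infinity>S\<in>ordered_set_partitions {1..k}.
      \<Sum>\<^sub>\<infinity>m\<in>decr_tuples (length S). V_term k x (spread {1..k} S m))"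
    using infsum_Sigma'_banach[of "\<lambda>S m. V_term k x (spread {1..k} S m)"] by simp
  \<comment> \<open>There are finitely many partitions, so the outer infinite sum is an ordinary
    one.\<close>
  then show "V k x = (\<Sum>S\<in>ordered_set_partitions {1..k}. mzeta (length S) (expo k x S))"
    by (simp add: finite_ordered_set_partitions mzeta_def V_term_spread[OF assms]
        del: One_nat_def cong: sum.cong infsum_cong)
qed

end
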